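(* Let $n\ge 2$, $X=\{1,\dots,n\}$, and let $\circ\colon[0,\infty)^2\to[0,\infty)$ be nondecreasing (that is, $a\circ b\le c\circ d$ whenever $a\le c$ and $b\le d$). Then the following are equivalent: (1) for every $f\colon X\to[0,\infty)$ and all symmetric monotone measures $\mu,\widehat{\mu}$ on $2^X$ with $\mu\ge\widehat{\mu}$, $$\sup_{\{D_l\subset\dots\subset D_1\}\in\mathcal{H}_{\mathrm{chain}}}\ \sum_{i=1}^{l}\Big(\min_{x\in D_i}f(x)\Big)\circ\big(\mu(D_i)-\widehat{\mu}(D_{i+1})\big)=\mathfrak{C}^{\mu,\widehat{\mu}}_{\circ}(f),$$ where $D_{l+1}=\emptyset$; (2) for every $a\in[0,\infty)$ the function $x\mapsto a\circ x$ is subadditive, i.e. $a\circ(x+y)\le a\circ x+a\circ y$ for all $x,y\in[0,\infty)$.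
   Context: A monotone measure on $2^X$ is a function $\mu\colon 2^X\to[0,\infty)$ with $\mu(\emptyset)=0$ and $\mu(C)\le\mu(D)$ whenever $C\subset D$. It is symmetric if $|C|=|D|$ implies $\mu(C)=\mu(D)$. Write $\mu\ge\widehat{\mu}$ if $\mu(D)\ge\widehat{\mu}(D)$ for all $D\subseteq X$. $\mathcal{H}_{\mathrm{chain}}$ is the family of all chains $\{D_l,\dots,D_1\}$, $l\ge 1$, of nonempty subsets of $X$ with strict inclusions $D_l\subset D_{l-1}\subset\dots\subset D_1$ ($D_1$ need not equal $X$). For $f\colon X\to[0,\infty)$ let $(\cdot)\colon X\to X$ be a permutation with $f_{(1)}\le\dots\le f_{(n)}$, where $f_{(i)}=f((i))$, and put $B_{(i)}=\{(i),\dots,(n)\}$ for $1\le i\le n$, $B_{(n+1)}=\emptyset$. Define $$\mathfrak{C}^{\mu,\widehat{\mu}}_{\circ}(f)=\sum_{i=1}^n f_{(i)}\circ\big(\mu(B_{(i)})-\widehat{\mu}(B_{(i+1)})\big).$$ For symmetric $\mu,\widehat{\mu}$ this value does not depend on the choice of the permutation. The left-hand side in (1) is the special case of the Choquet-Sugeno-like operator $\sup_{\mathcal{D}\in\mathcal{H}}\sum_{(C,D)\in\mathcal{R}}\mathrm{L}(\mathsf{A}(f|C),\widehat{\mathsf{A}}(f|D),\mu(C),\widehat{\mu}(D))$ with $\mathcal{H}=\mathcal{H}_{\mathrm{chain}}$, $\mathcal{R}=\{(D_1,D_2),\dots,(D_l,D_{l+1})\}$, $\mathsf{A}(f|C)=\inf_{x\in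 C}f(x)$ and $\mathrm{L}(x,y,z,w)=x\circ(z-w)_+$. *)

theory Defs
  imports Complex_Main "HOL-Combinatorics.Permutations"
begin

definition monotone_measure :: "'a set \<Rightarrow> ('a set \<Rightarrow> real) \<Rightarrow> bool" where
  "monotone_measure X \<mu> \<longleftrightarrow>
     (\<forall>C\<subseteq>X. 0 \<le> \<mu> C) \<and> \<mu> {} = 0 \<and> mono_on (Pow X) \<mu>"

definition symmetric_measure :: "'a set \<Rightarrow> ('a set \<Rightarrow> real) \<Rightarrow> bool" where
  "symmetric_measure X \<mu> \<longleftrightarrow> (\<forall>C\<subseteq>X. \<forall>D\<subseteq>X. card C = card D \<longrightarrow> \<mu> C = \<mu> D)"

text \<open>
  A chain \<open>D\<^sub>l \<subset> \<dots> \<subset> D\<^sub>1\<close> of nonempty subsets of \<open>X\<close> is given by its length \<open>l\<close> and its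
  decreasing enumeration \<open>D 1, \<dots>, D l\<close>, extended by the convention \<open>D (l + 1) = {}\<close>.
  The values of \<open>D\<close> outside \<open>{1..l + 1}\<close> are irrelevant.
\<close>

definition H_chain :: "'a set \<Rightarrow> (nat \<times> (nat \<Rightarrow> 'a set)) set" where
  "H_chain X = {(l, D). 1 \<le> l \<and> (\<forall>i\<in>{1..l}. D i \<noteq> {} \<and> D i \<subseteq> X) \<and>
     (\<forall>i\<in>{1..<l}. D (i + 1) \<subset> D i) \<and> D (l + 1) = {}}"

definition chain_sum ::
  "(real \<Rightarrow> real \<Rightarrow> real) \<Rightarrow> ('a set \<Rightarrow> real) \<Rightarrow> ('a set \<Rightarrow> real) \<Rightarrow> ('a \<Rightarrow> real) \<Rightarrow>
     nat \<Rightarrow> (nat \<Rightarrow> 'a set) \<Rightarrow> real" where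
  "chain_sum circ \<mu> \<nu> f l D =
     (\<Sum>i = 1..l. circ (Min (f ` D i)) (\<mu> (D i) - \<nu> (D (i + 1))))"

text \<open>
  The permutation \<open>(\<cdot>)\<close> is \<open>p\<close>; thus \<open>f\<^bsub>(i)\<^esub> = f (p i)\<close> and \<open>B\<^bsub>(i)\<^esub> = p ` {i..n}\<close>, which is
  empty for \<open>i = n + 1\<close>.
\<close>

definition sorts :: "nat \<Rightarrow> (nat \<Rightarrow> real) \<Rightarrow> (nat \<Rightarrow> nat) \<Rightarrow> bool" where
  "sorts n f p \<longleftrightarrow> p permutes {1..n} \<and> mono_on {1..n} (\<lambda>i. f (p i))"

definition gen_choquet_wrt ::
  "(nat \<Rightarrow> nat) \<Rightarrow> nat \<Rightarrow> (real \<Rightarrow> real \<Rightarrow> real) \<Rightarrow> (nat set \<Rightarrow> real) \<Rightarrow> (nat set \<Rightarrow> real) \<Rightarrow>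
     (nat \<Rightarrow> real) \<Rightarrow> real" where
  "gen_choquet_wrt p n circ \<mu> \<nu> f =
     (\<Sum>i = 1..n. circ (f (p i)) (\<mu> (p ` {i..n}) - \<nu> (p ` {i + 1..n})))"

text \<open>
  The choice of the sorting permutation is immaterial for symmetric measures: see
  \<open>sorts_exists\<close> and \<open>gen_choquet_eq\<close> below.
\<close>

definition gen_choquet ::
  "nat \<Rightarrow> (real \<Rightarrow> real \<Rightarrow> real) \<Rightarrow> (nat set \<Rightarrow> real) \<Rightarrow> (nat set \<Rightarrow> real) \<Rightarrow>
     (nat \<Rightarrow> real) \<Rightarrow> real" where
  "gen_choquet n circ \<mu> \<nu> f = gen_choquet_wrt (SOME p. sorts n f p) n circ \<mu> \<nu> f"

lemma sorts_exists: "\<exists>p. sorts n f p"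
proof -
  define xs where "xs = sort_key f [1..<Suc n]"
  have len: "length xs = n" and dist: "distinct xs" and set: "set xs = {1..n}"
    by (auto simp: xs_def simp del: upt_Suc)
  have srt: "sorted (map f xs)"
    by (simp add: xs_def)
  define p where "p = (\<lambda>i. if i \<in> {1..n} then xs ! (i - 1) else i)"
  have "bij_betw (\<lambda>i. i - 1) {1..n} {..<n}"
    by (rule bij_betw_byWitness[where f' = Suc]) auto
  moreover have "bij_betw ((!) xs) {..<n} {1..n}"
    using bij_betw_nth[OF dist] len set by auto
  ultimately have "bij_betw ((!) xs \<circ> (\<lambda>i. i - 1)) {1..n} {1..n}"
    by (rule bij_betw_trans)
  then have "bij_betw p {1..n} {1..n}"
    by (rule bij_betw_cong[THEN iffD1, rotated]) (simp add: p_def)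
  then have "p permutes {1..n}"
    by (rule bij_imp_permutes) (auto simp: p_def)
  moreover have "mono_on {1..n} (\<lambda>i. f (p i))"
  proof (rule mono_onI)
    fix r s assume "r \<in> {1..n}" "s \<in> {1..n}" "r \<le> s"
    then show "f (p r) \<le> f (p s)"
      using sorted_nth_mono[OF srt, of "r - 1" "s - 1"] len by (simp add: p_def)
  qed
  ultimately show ?thesis
    unfolding sorts_def by blast
qed

lemma sorts_values_unique:
  assumes "sorts n f p" "sorts n f q" "i \<in> {1..n}"
  shows "f (p i) = f (q i)"
proof -
  have srt: "sorted (map (\<lambda>i. f (r i)) [1..<Suc n])" if "sorts n f r" for r
    using that by (auto simp: sorts_def sorted_iff_nth_mono mono_on_def simp del: upt_Suc)
  have ms: "mset (map (\<lambda>i. f (r i)) [1..<Suc n]) = image_mset f (mset_set {1..n})"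
    if "sorts n f r" for r
  proof -
    have "image_mset r (mset_set {1..n}) = mset_set {1..n}"
      using that by (simp add: sorts_def permutes_image_mset)
    then have "image_mset f (image_mset r (mset_set {1..n})) = image_mset f (mset_set {1..n})"
      by simp
    moreover have "mset [1..<Suc n] = mset_set {1..n}"
      by (metis atLeastLessThanSuc_atLeastAtMost mset_upt)
    ultimately show ?thesis
      by (simp add: multiset.map_comp o_def del: upt_Suc)
  qed
  have "map (\<lambda>i. f (p i)) [1..<Suc n] = map (\<lambda>i. f (q i)) [1..<Suc n]"
    using properties_for_sort[OF ms[OF assms(1), folded ms[OF assms(2)]] srt[OF assms(1)]]
      properties_for_sort[OF refl srt[OF assms(2)]] by (rule trans[OF sym])
  then show ?thesis
    using assms(3) by (auto simp del: upt_Suc)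
qed

lemma gen_choquet_eq:
  assumes "symmetric_measure {1..n} \<mu>" "symmetric_measure {1..n} \<nu>" "sorts n f p"
  shows "gen_choquet n circ \<mu> \<nu> f = gen_choquet_wrt p n circ \<mu> \<nu> f"
proof -
  define q where "q = (SOME p. sorts n f p)"
  have q: "sorts n f q"
    unfolding q_def by (rule someI_ex[OF sorts_exists])
  have card: "card (r ` {i..n}) = card {i..n}" if "sorts n f r" for r i
    using that unfolding sorts_def by (blast intro: card_image permutes_inj_on)
  have sub: "r ` {i..n} \<subseteq> {1..n}" if "sorts n f r" "1 \<le> i" for r i
    using that permutes_image[of r "{1..n}"] by (auto simp: sorts_def)
  have eq: "m (q ` {i..n}) = m (p ` {i..n})"
    if "symmetric_measure {1..n} m" "1 \<le> i" for m i
    by (rule that(1)[unfolded symmetric_measure_def, rule_format,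
          OF sub[OF q that(2)] sub[OF assms(3) that(2)]])
      (simp only: card[OF q] card[OF assms(3)])
  show ?thesis
    unfolding gen_choquet_def q_def[symmetric] gen_choquet_wrt_def
  proof (rule sum.cong[OF refl])
    fix i assume i: "i \<in> {1..n}"
    have "\<mu> (q ` {i..n}) = \<mu> (p ` {i..n})" "\<nu> (q ` {i + 1..n}) = \<nu> (p ` {i + 1..n})"
      using i by (intro eq assms; simp)+
    with sorts_values_unique[OF q assms(3) i]
    show "circ (f (q i)) (\<mu> (q ` {i..n}) - \<nu> (q ` {i + 1..n})) =
        circ (f (p i)) (\<mu> (p ` {i..n}) - \<nu> (p ` {i + 1..n}))"
      by simp
  qed
qed

text \<open>
  The supremum over chains is taken over a nonempty finite set of reals, so the real-valued
  \<open>Sup\<close> is the true supremum.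
\<close>

lemma H_chain_nonempty: "X \<noteq> {} \<Longrightarrow> H_chain X \<noteq> {}"
proof -
  assume "X \<noteq> {}"
  then have "(1, \<lambda>i. if i = 1 then X else {}) \<in> H_chain X"
    by (auto simp: H_chain_def)
  then show ?thesis by blast
qed

lemma H_chain_length:
  assumes "finite X" "(l, D) \<in> H_chain X"
  shows "l \<le> card X"
proof -
  have D: "\<And>i. i \<in> {1..l} \<Longrightarrow> D i \<noteq> {} \<and> D i \<subseteq> X"
    and dec: "\<And>i. i \<in> {1..<l} \<Longrightarrow> D (i + 1) \<subset> D i"
    and "1 \<le> l"
    using assms(2) by (auto simp: H_chain_def)
  have "k < l \<longrightarrow> Suc k \<le> card (D (l - k))" for k
  proof (induction k)
    case 0
    show ?case
      using D[of l] \<open>1 \<le> l\<close> assms(1) by (auto simp: Suc_le_eq card_gt_0_iff intro: finite_subset)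
  next
    case (Suc k)
    show ?case
    proof
      assume k: "Suc k < l"
      then have "D (l - k) \<subset> D (l - Suc k)"
        using dec[of "l - Suc k"] by (simp add: Suc_diff_Suc)
      moreover have "finite (D (l - Suc k))"
        using D[of "l - Suc k"] k finite_subset[OF _ assms(1)] by simp
      ultimately have "card (D (l - k)) < card (D (l - Suc k))"
        by (intro psubset_card_mono)
      then show "Suc (Suc k) \<le> card (D (l - Suc k))"
        using Suc k by linarith
    qed
  qed
  from this[of "l - 1"] have "l \<le> card (D 1)"
    using \<open>1 \<le> l\<close> by simp
  also have "\<dots> \<le> card X"
    using D[of 1] \<open>1 \<le> l\<close> assms(1) by (intro card_mono) auto
  finally show ?thesis .
qed

lemma finite_chain_sums:
  assumes "finite X"
  shows "finite ((\<lambda>(l, D). chain_sum circ \<mu> \<nu> f l D) ` H_chain X)"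
proof -
  define g where "g xs = (\<Sum>i = 1..length xs - 1.
     circ (Min (f ` (xs ! (i - 1)))) (\<mu> (xs ! (i - 1)) - \<nu> (xs ! i)))" for xs :: "'a set list"
  have "(\<lambda>(l, D). chain_sum circ \<mu> \<nu> f l D) ` H_chain X
      \<subseteq> g ` {xs. set xs \<subseteq> Pow X \<and> length xs \<le> Suc (card X)}"
  proof (clarify)
    fix l D assume lD: "(l, D) \<in> H_chain X"
    define xs where "xs = map D [1..<Suc (Suc l)]"
    have nth: "xs ! i = D (Suc i)" if "i \<le> l" for i
      using that by (simp add: xs_def del: upt_Suc)
    have len: "length xs = Suc l" by (simp add: xs_def)
    have "D i \<subseteq> X" if "1 \<le> i" "i \<le> Suc l" for i
      using lD that by (cases "i = Suc l") (auto simp: H_chain_def)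
    then have "set xs \<subseteq> Pow X"
      by (fastforce simp: xs_def simp del: upt_Suc)
    moreover have "chain_sum circ \<mu> \<nu> f l D = g xs"
      unfolding chain_sum_def g_def len by (intro sum.cong) (auto simp: nth)
    ultimately show "chain_sum circ \<mu> \<nu> f l D
        \<in> g ` {xs. set xs \<subseteq> Pow X \<and> length xs \<le> Suc (card X)}"
      using len H_chain_length[OF assms lD] by auto
  qed
  moreover have "finite {xs. set xs \<subseteq> Pow X \<and> length xs \<le> Suc (card X)}"
    using assms by (intro finite_lists_length_le) simp
  ultimately show ?thesis
    by (rule finite_subset[OF _ finite_imageI])
qed

end

(* Symmetric measures depend only on cardinalities, say \<mu> D = m |D| and \<nu> D = v |D|. Since v \<le> m,
   a jump m k - v k' of a chain from level k to level k' is at most the sum of the unit jumps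
   m j - v (j - 1) for k' < j \<le> k. So, by subadditivity, refining a chain to a maximal one only increases
   the sum, and the best maximal chain is the one of the upper level sets of f, whose value is the
   Choquet-like sum. Conversely, for f constantly a and \<mu> = \<nu> taking the values 0, x, x + y, x + y, ...
   on cardinalities 0, 1, 2, 3, ..., a chain that skips only cardinality 1 differs from a maximal chain
   by having the term for x + y in place of those for x and y. *)

theory Submission imports Defs begin

section \<open>Cardinalities and order statistics\<close>

text \<open>The segment \<open>{1..card D}\<close> serves as the representative of its cardinality,
  which turns a symmetric measure into a function of a number.\<close>

lemma symmetric_measure_card:
  assumes "symmetric_measure {1..n::nat} \<mu>" "D \<subseteq> {1..n}"
  shows "\<mu> D = \<mu> {1..card D}"
proof -
  have "card D \<le> n"
    using card_mono[OF _ assms(2)] by simp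
  then have "{1..card D} \<subseteq> {1..n}"
    by auto
  then show ?thesis
    using assms unfolding symmetric_measure_def by (metis card_atLeastAtMost diff_Suc_1)
qed

text \<open>Pigeonhole: \<open>D\<close> and the points at the first \<open>n + 1 - card D\<close>
  sorted positions have \<open>n + 1\<close> elements in total, so inside \<open>{1..n}\<close> they
  share a point, and the value of \<open>f\<close> there lies between the two sides.\<close>

lemma Min_le_order_statistic:
  assumes p: "sorts n f p" and D: "D \<subseteq> {1..n}" "D \<noteq> {}"
  shows "Min (f ` D) \<le> f (p (n + 1 - card D))"
proof -
  have fin: "finite D"
    using D(1) finite_subset by blast
  have card: "1 \<le> card D" "card D \<le> n"
    using fin D card_mono[OF _ D(1)] by (auto simp: Suc_le_eq card_gt_0_iff)
  have perm: "p permutes {1..n}"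
    using p by (simp add: sorts_def)
  define E where "E = p ` {1..n + 1 - card D}"
  have "{1..n + 1 - card D} \<subseteq> {1..n}"
    using card by auto
  then have E: "E \<subseteq> {1..n}"
    unfolding E_def using permutes_image[OF perm] by blast
  have "card E = n + 1 - card D"
    unfolding E_def using perm by (subst card_image) (auto intro: permutes_inj_on)
  have "D \<inter> E \<noteq> {}"
  proof
    assume "D \<inter> E = {}"
    then have "card (D \<union> E) = card D + card E"
      using fin by (intro card_Un_disjoint) (auto simp: E_def)
    moreover have "card (D \<union> E) \<le> n"
      using card_mono[of "{1..n}" "D \<union> E"] D(1) E by simp
    ultimately show False
      using \<open>card E = n + 1 - card D\<close> card by simp
  qed
  then obtain i where i: "p i \<in> D" "1 \<le> i" "i \<le> n + 1 - card D"
    by (auto simp: E_def)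
  have "Min (f ` D) \<le> f (p i)"
    using fin i by simp
  also have "\<dots> \<le> f (p (n + 1 - card D))"
    using p i card unfolding sorts_def by (auto intro: mono_onD)
  finally show ?thesis .
qed

section \<open>Splitting jumps of a chain into unit jumps\<close>

text \<open>Induction on the upper level: subadditivity splits off the top unit jump with factor
  \<open>F (Suc k)\<close>, and in the remaining jump from \<open>k\<close> to \<open>k'\<close>
  this factor may be raised to \<open>F k\<close> because \<open>F\<close> is nonincreasing.\<close>

lemma subadditive_jump_le:
  fixes circ :: "real \<Rightarrow> real \<Rightarrow> real" and F m v :: "nat \<Rightarrow> real"
  assumes circ_mono: "\<And>a b c d. 0 \<le> a \<Longrightarrow> a \<le> c \<Longrightarrow> 0 \<le> b \<Longrightarrow> b \<le> d \<Longrightarrow> circ a b \<le> circ c d"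
    and sub: "\<And>a x y. 0 \<le> a \<Longrightarrow> 0 \<le> x \<Longrightarrow> 0 \<le> y \<Longrightarrow> circ a (x + y) \<le> circ a x + circ a y"
    and F_nonneg: "\<And>k. 1 \<le> k \<Longrightarrow> k \<le> n \<Longrightarrow> 0 \<le> F k"
    and F_anti: "\<And>k. 1 \<le> k \<Longrightarrow> Suc k \<le> n \<Longrightarrow> F (Suc k) \<le> F k"
    and m_mono: "\<And>j k. j \<le> k \<Longrightarrow> k \<le> n \<Longrightarrow> m j \<le> m k"
    and v_le_m: "\<And>k. k \<le> n \<Longrightarrow> v k \<le> m k"
    and k: "k' < k" "k \<le> n"
  shows "circ (F k) (m k - v k') \<le> (\<Sum>j\<in>{k'<..k}. circ (F j) (m j - v (j - 1)))"
  using k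
proof (induction k)
  case 0
  then show ?case by simp
next
  case (Suc k)
  have split: "(\<Sum>j\<in>{k'<..Suc k}. circ (F j) (m j - v (j - 1))) =
      circ (F (Suc k)) (m (Suc k) - v k) + (\<Sum>j\<in>{k'<..k}. circ (F j) (m j - v (j - 1)))"
  proof -
    have "{k'<..Suc k} = insert (Suc k) {k'<..k}"
      using Suc.prems by auto
    then show ?thesis by simp
  qed
  show ?case
  proof (cases "k' = k")
    case True
    with split show ?thesis by simp
  next
    case False
    with Suc.prems have k: "k' < k" "k \<le> n" "1 \<le> k" by auto
    \<comment> \<open>Three of these keep the arguments of \<open>circ\<close> nonnegative, as
      \<open>circ_mono\<close> and \<open>sub\<close> demand. The other one,
      \<open>v k \<le> m k\<close>, bounds the whole jump by the sum of its two pieces.\<close>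
    have le: "v k' \<le> m k" "v k \<le> m (Suc k)" "v k \<le> m k" "v k' \<le> m (Suc k)"
      using k Suc.prems m_mono[of k' k] m_mono[of k "Suc k"] v_le_m[of k] v_le_m[of k']
      by auto
    have F: "0 \<le> F (Suc k)" "F (Suc k) \<le> F k"
      using F_nonneg[of "Suc k"] F_anti[of k] Suc.prems k by auto
    have "circ (F (Suc k)) (m (Suc k) - v k')
        \<le> circ (F (Suc k)) ((m (Suc k) - v k) + (m k - v k'))"
      using le F by (intro circ_mono) auto
    also have "\<dots> \<le> circ (F (Suc k)) (m (Suc k) - v k) + circ (F (Suc k)) (m k - v k')"
      using le F by (intro sub) auto
    also have "circ (F (Suc k)) (m k - v k') \<le> circ (F k) (m k - v k')"
      using le F by (intro circ_mono) auto
    also have "\<dots> \<le> (\<Sum>j\<in>{k'<..k}. circ (F j) (m j - v (j - 1)))"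
      using Suc.IH k by simp
    finally show ?thesis
      using split by simp
  qed
qed

text \<open>The intervals \<open>{c (Suc i)<..c i}\<close> tile \<open>{c (Suc l)<..c 1}\<close>, so
  the bounds for single jumps add up without overlap.\<close>

lemma sum_decreasing_jumps_le:
  fixes h T :: "nat \<Rightarrow> real" and c :: "nat \<Rightarrow> nat"
  assumes jump: "\<And>i. 1 \<le> i \<Longrightarrow> i \<le> l \<Longrightarrow> h i \<le> (\<Sum>j\<in>{c (Suc i)<..c i}. T j)"
    and dec: "\<And>i. 1 \<le> i \<Longrightarrow> i \<le> l \<Longrightarrow> c (Suc i) \<le> c i"
  shows "(\<Sum>i = 1..l. h i) \<le> (\<Sum>j\<in>{c (Suc l)<..c 1}. T j)"
  using assms
proof (induction l)
  case 0
  then show ?case by simp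
next
  case (Suc l)
  note dec = Suc.prems(2)
  have "Suc i \<le> Suc l \<longrightarrow> c (Suc i) \<le> c 1" for i
  proof (induction i)
    case (Suc i)
    then show ?case
      using dec[of "Suc i"] by auto
  qed simp
  then have desc: "c (Suc l) \<le> c 1"
    by blast
  have "{c (Suc (Suc l))<..c 1} = {c (Suc (Suc l))<..c (Suc l)} \<union> {c (Suc l)<..c 1}"
    using desc dec[of "Suc l"] by auto
  then have "(\<Sum>j\<in>{c (Suc (Suc l))<..c 1}. T j) =
      (\<Sum>j\<in>{c (Suc (Suc l))<..c (Suc l)}. T j) + (\<Sum>j\<in>{c (Suc l)<..c 1}. T j)"
    by (simp add: sum.union_disjoint ivl_disj_int)
  then show ?case
    using add_mono[OF Suc.IH[OF Suc.prems] Suc.prems(1)[of "Suc l"]] by simp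
qed

section \<open>Chain sums against the Choquet-like sum\<close>

text \<open>Reindexing by the cardinality \<open>k = n + 1 - i\<close> of the upper level set puts
  the sum in the form produced by unit jumps.\<close>

lemma gen_choquet_eq_sum_levels:
  assumes "symmetric_measure {1..n} \<mu>" "symmetric_measure {1..n} \<nu>" "sorts n f p"
  shows "gen_choquet n circ \<mu> \<nu> f =
    (\<Sum>k = 1..n. circ (f (p (n + 1 - k))) (\<mu> {1..k} - \<nu> {1..k - 1}))"
proof -
  have perm: "p permutes {1..n}"
    using assms(3) by (simp add: sorts_def)
  have meas: "M (p ` {i..n}) = M {1..n + 1 - i}"
    if "symmetric_measure {1..n} M" "1 \<le> i" for M :: "nat set \<Rightarrow> real" and i
  proof -
    have "p ` {i..n} \<subseteq> {1..n}"
      using permutes_image[OF perm] that(2) by fastforce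
    moreover have "card (p ` {i..n}) = n + 1 - i"
      using perm by (subst card_image) (auto intro: permutes_inj_on)
    ultimately show ?thesis
      using symmetric_measure_card[OF that(1)] by metis
  qed
  have "gen_choquet n circ \<mu> \<nu> f =
      (\<Sum>i = 1..n. circ (f (p i)) (\<mu> {1..n + 1 - i} - \<nu> {1..n - i}))"
    unfolding gen_choquet_eq[OF assms] gen_choquet_wrt_def
    by (intro sum.cong refl) (simp add: meas[OF assms(1)] meas[OF assms(2)])
  also have "\<dots> = (\<Sum>k = 1..n. circ (f (p (n + 1 - k))) (\<mu> {1..k} - \<nu> {1..k - 1}))"
    by (subst sum.atLeastAtMost_rev) (intro sum.cong refl, auto)
  finally show ?thesis .
qed

lemma chain_sum_le_gen_choquet:
  fixes n :: nat and circ :: "real \<Rightarrow> real \<Rightarrow> real"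
  assumes circ_nonneg: "\<And>a b. 0 \<le> a \<Longrightarrow> 0 \<le> b \<Longrightarrow> 0 \<le> circ a b"
    and circ_mono: "\<And>a b c d. 0 \<le> a \<Longrightarrow> a \<le> c \<Longrightarrow> 0 \<le> b \<Longrightarrow> b \<le> d \<Longrightarrow> circ a b \<le> circ c d"
    and sub: "\<And>a x y. 0 \<le> a \<Longrightarrow> 0 \<le> x \<Longrightarrow> 0 \<le> y \<Longrightarrow> circ a (x + y) \<le> circ a x + circ a y"
    and f: "\<forall>x\<in>{1..n}. 0 \<le> f x"
    and \<mu>: "monotone_measure {1..n} \<mu>" "symmetric_measure {1..n} \<mu>"
    and \<nu>: "symmetric_measure {1..n} \<nu>"
    and le: "\<forall>D\<subseteq>{1..n}. \<nu> D \<le> \<mu> D"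
    and chain: "(l, D) \<in> H_chain {1..n}"
  shows "chain_sum circ \<mu> \<nu> f l D \<le> gen_choquet n circ \<mu> \<nu> f"
proof -
  obtain p where p: "sorts n f p"
    using sorts_exists by blast
  \<comment> \<open>\<open>F k\<close> is the \<open>k\<close>-th largest value of \<open>f\<close>,
    an upper bound for the minimum of \<open>f\<close> over any \<open>k\<close> points.\<close>
  define F where "F k = f (p (n + 1 - k))" for k
  define m where "m k = \<mu> {1..k}" for k
  define v where "v k = \<nu> {1..k}" for k
  define T where "T k = circ (F k) (m k - v (k - 1))" for k
  define c where "c i = card (D i)" for i
  have range: "p i \<in> {1..n}" if "1 \<le> i" "i \<le> n" for i
    using p that permutes_in_image[of p "{1..n}" i] by (simp add: sorts_def)
  have F_nonneg: "0 \<le> F k" if "1 \<le> k" "k \<le> n" for k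
    using f range[of "n + 1 - k"] that by (auto simp: F_def)
  have F_anti: "F (Suc k) \<le> F k" if "1 \<le> k" "Suc k \<le> n" for k
    using p that mono_onD[of "{1..n}" "\<lambda>i. f (p i)" "n + 1 - Suc k" "n + 1 - k"]
    unfolding F_def sorts_def by auto
  have m_mono: "m j \<le> m k" if "j \<le> k" "k \<le> n" for j k
    using \<mu>(1) that mono_onD[of "Pow {1..n}" \<mu> "{1..j}" "{1..k}"]
    unfolding m_def monotone_measure_def by auto
  have v_le_m: "v k \<le> m k" if "k \<le> n" for k
    using le that by (auto simp: m_def v_def)
  have D: "D i \<noteq> {}" "D i \<subseteq> {1..n}" if "1 \<le> i" "i \<le> l" for i
    using chain that by (auto simp: H_chain_def)
  have D_end: "D (Suc l) = {}" and l: "1 \<le> l"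
    using chain by (auto simp: H_chain_def)
  have fin: "finite (D i)" if "1 \<le> i" "i \<le> l" for i
    using D[OF that] finite_subset by blast
  \<comment> \<open>The case \<open>i = l\<close> is the final drop to the empty set, strict because
    \<open>D l\<close> is nonempty.\<close>
  have D_dec: "D (Suc i) \<subset> D i" if "1 \<le> i" "i \<le> l" for i
    using chain that D[OF that] D_end by (cases "i = l") (auto simp: H_chain_def)
  have c_dec: "c (Suc i) < c i" if "1 \<le> i" "i \<le> l" for i
    unfolding c_def by (rule psubset_card_mono[OF fin[OF that] D_dec[OF that]])
  have c_le: "c i \<le> n" if "1 \<le> i" "i \<le> l" for i
    using card_mono[OF _ D(2)[OF that]] by (simp add: c_def)
  have jump: "circ (Min (f ` D i)) (\<mu> (D i) - \<nu> (D (i + 1))) \<le> (\<Sum>j\<in>{c (Suc i)<..c i}. T j)"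
    if i: "1 \<le> i" "i \<le> l" for i
  proof -
    have meas: "\<mu> (D i) = m (c i)" "\<nu> (D (i + 1)) = v (c (Suc i))"
      using symmetric_measure_card[OF \<mu>(2) D(2)[OF i]]
        symmetric_measure_card[OF \<nu> order_trans[OF psubset_imp_subset[OF D_dec[OF i]] D(2)[OF i]]]
      unfolding m_def v_def c_def Suc_eq_plus1 by blast+
    have "0 \<le> Min (f ` D i)"
      using D[OF i] f fin[OF i] by (subst Min_ge_iff) auto
    moreover have "Min (f ` D i) \<le> F (c i)"
      unfolding F_def c_def by (rule Min_le_order_statistic[OF p D(2)[OF i] D(1)[OF i]])
    moreover have "v (c (Suc i)) \<le> m (c i)"
      using v_le_m[of "c (Suc i)"] m_mono[of "c (Suc i)" "c i"] c_dec[OF i] c_le[OF i] by simp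
    ultimately have "circ (Min (f ` D i)) (\<mu> (D i) - \<nu> (D (i + 1)))
        \<le> circ (F (c i)) (m (c i) - v (c (Suc i)))"
      unfolding meas by (intro circ_mono) auto
    also have "\<dots> \<le> (\<Sum>j\<in>{c (Suc i)<..c i}. T j)"
      unfolding T_def
      by (rule subadditive_jump_le[where circ = circ and F = F and m = m and v = v and n = n,
            OF circ_mono sub F_nonneg F_anti m_mono v_le_m
            c_dec[OF i] c_le[OF i]])
    finally show ?thesis .
  qed
  have "chain_sum circ \<mu> \<nu> f l D \<le> (\<Sum>j\<in>{c (Suc l)<..c 1}. T j)"
    unfolding chain_sum_def by (rule sum_decreasing_jumps_le[where c = c and T = T and l = l,
        OF jump less_imp_le[OF c_dec]])
  \<comment> \<open>The chain may start below the full set; the terms of the levels above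
    \<open>c 1\<close> are nonnegative and can be added.\<close>
  also have "\<dots> \<le> (\<Sum>j = 1..n. T j)"
  proof (rule sum_mono2)
    show "{c (Suc l)<..c 1} \<subseteq> {1..n}"
      using c_le[of 1] l by auto
    fix j assume "j \<in> {1..n} - {c (Suc l)<..c 1}"
    then have "1 \<le> j" "j \<le> n" "j - 1 \<le> n"
      by auto
    then show "0 \<le> T j"
      using F_nonneg[of j] v_le_m[of "j - 1"] m_mono[of "j - 1" j]
      unfolding T_def by (intro circ_nonneg) auto
  qed simp
  also have "\<dots> = gen_choquet n circ \<mu> \<nu> f"
    unfolding gen_choquet_eq_sum_levels[OF \<mu>(2) \<nu> p] T_def F_def m_def v_def ..
  finally show ?thesis .
qed

lemma gen_choquet_is_chain_sum:
  assumes "1 \<le> n" "symmetric_measure {1..n} \<mu>" "symmetric_measure {1..n} \<nu>"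
  obtains D where "(n, D) \<in> H_chain {1..n}"
    and "chain_sum circ \<mu> \<nu> f n D = gen_choquet n circ \<mu> \<nu> f"
proof -
  obtain p where p: "sorts n f p"
    using sorts_exists by blast
  then have perm: "p permutes {1..n}" and mono: "mono_on {1..n} (\<lambda>i. f (p i))"
    by (auto simp: sorts_def)
  define D where "D i = p ` {i..n}" for i
  have "D i \<subseteq> {1..n}" if "1 \<le> i" for i
    unfolding D_def using permutes_image[OF perm] that by fastforce
  moreover have "D (i + 1) \<subset> D i" if "1 \<le> i" "i \<le> n" for i
  proof -
    have "{i + 1..n} \<subset> {i..n}"
      using that by auto
    then show ?thesis
      unfolding D_def using inj_image_subset_iff[OF permutes_inj[OF perm]] by (metis less_le_not_le)
  qed
  ultimately have "(n, D) \<in> H_chain {1..n}"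
    using assms(1) by (auto simp: H_chain_def D_def)
  moreover have "Min (f ` D i) = f (p i)" if "i \<in> {1..n}" for i
    using that mono unfolding D_def
    by (intro Min_eqI) (auto intro: mono_onD)
  then have "chain_sum circ \<mu> \<nu> f n D = gen_choquet n circ \<mu> \<nu> f"
    unfolding gen_choquet_eq[OF assms(2,3) p] gen_choquet_wrt_def chain_sum_def
    by (intro sum.cong refl) (simp add: D_def)
  ultimately show thesis ..
qed

text \<open>The chain sums form a finite set, hence are bounded above, and the real-valued supremum
  dominates each of them.\<close>

lemma chain_sum_le_SUP:
  assumes "finite X" "(l, D) \<in> H_chain X"
  shows "chain_sum circ \<mu> \<nu> f l D \<le> (SUP (l, D) \<in> H_chain X. chain_sum circ \<mu> \<nu> f l D)"
  using cSUP_upper[OF assms(2) bdd_above_finite[OF finite_chain_sums[OF assms(1)]]] by simp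

section \<open>Necessity of subadditivity\<close>

text \<open>A constant function turns every minimum into \<open>a\<close>, so only the jumps of the
  measure matter. Both sums contain \<open>n - 2\<close> copies of \<open>circ a 0\<close>; this
  value may be nonzero, but the copies cancel.\<close>

lemma subadditive_if_chain_sum_le:
  fixes n :: nat and circ :: "real \<Rightarrow> real \<Rightarrow> real" and a x y :: real
  assumes n: "n \<ge> 2" and xy: "0 \<le> x" "0 \<le> y"
  defines "\<mu> \<equiv> \<lambda>D :: nat set. if card D = 0 then 0 else if card D = 1 then x else x + y"
  assumes le: "\<And>l D. (l, D) \<in> H_chain {1..n} \<Longrightarrow>
    chain_sum circ \<mu> \<mu> (\<lambda>_. a) l D \<le> gen_choquet n circ \<mu> \<mu> (\<lambda>_. a)"
  shows "circ a (x + y) \<le> circ a x + circ a y"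
proof -
  have sym: "symmetric_measure {1..n} \<mu>"
    by (simp add: symmetric_measure_def \<mu>_def)
  obtain k where k: "n = Suc (Suc k)"
    using n by (metis Suc_le_D numeral_2_eq_2 Suc_le_mono)
  \<comment> \<open>The chain ends with the pair \<open>{n - 1..n}\<close> and then drops to the
    empty set, skipping the singleton; its last jump is \<open>x + y\<close>.\<close>
  define D where "D i = (if i = n then {} else {i..n})" for i
  have "(n - 1, D) \<in> H_chain {1..n}"
    using n by (auto simp: H_chain_def D_def)
  from le[OF this] have "chain_sum circ \<mu> \<mu> (\<lambda>_. a) (n - 1) D \<le> gen_choquet n circ \<mu> \<mu> (\<lambda>_. a)" .
  moreover have "chain_sum circ \<mu> \<mu> (\<lambda>_. a) (n - 1) D = circ a (x + y) + (\<Sum>i = 1..k. circ a 0)"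
  proof -
    have "chain_sum circ \<mu> \<mu> (\<lambda>_. a) (n - 1) D
        = (\<Sum>i = 1..Suc k. if i = Suc k then circ a (x + y) else circ a 0)"
      unfolding chain_sum_def k
      by (intro sum.cong) (auto simp: k D_def \<mu>_def image_constant_conv)
    then show ?thesis by simp
  qed
  moreover have "sorts n (\<lambda>_. a) id"
    by (simp add: sorts_def permutes_id mono_on_def)
  then have "gen_choquet n circ \<mu> \<mu> (\<lambda>_. a) = circ a x + circ a y + (\<Sum>i = 1..k. circ a 0)"
  proof -
    \<comment> \<open>The maximal chain passes through the singleton: cardinality 1 contributes the
      jump \<open>x\<close>, cardinality 2 the jump \<open>y\<close>.\<close>
    have "gen_choquet n circ \<mu> \<mu> (\<lambda>_. a) = (\<Sum>i = 1..Suc (Suc k).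
        if i = Suc (Suc k) then circ a x else if i = Suc k then circ a y else circ a 0)"
      unfolding gen_choquet_eq[OF sym sym \<open>sorts n (\<lambda>_. a) id\<close>] gen_choquet_wrt_def
      unfolding k
      by (intro sum.cong) (auto simp: \<mu>_def)
    then show ?thesis by simp
  qed
  ultimately show ?thesis by simp
qed

theorem theorem4p3:
  fixes n :: nat and circ :: "real \<Rightarrow> real \<Rightarrow> real"
  assumes n: "n \<ge> 2"
    and circ_nonneg: "\<And>a b. 0 \<le> a \<Longrightarrow> 0 \<le> b \<Longrightarrow> 0 \<le> circ a b"
    and circ_mono: "\<And>a b c d. 0 \<le> a \<Longrightarrow> a \<le> c \<Longrightarrow> 0 \<le> b \<Longrightarrow> b \<le> d \<Longrightarrow> circ a b \<le> circ c d"
  shows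
    "(\<forall>(f :: nat \<Rightarrow> real) (\<mu> :: nat set \<Rightarrow> real) (\<nu> :: nat set \<Rightarrow> real).
        (\<forall>x\<in>{1..n}. 0 \<le> f x) \<longrightarrow>
        monotone_measure {1..n} \<mu> \<longrightarrow> symmetric_measure {1..n} \<mu> \<longrightarrow>
        monotone_measure {1..n} \<nu> \<longrightarrow> symmetric_measure {1..n} \<nu> \<longrightarrow>
        (\<forall>D\<subseteq>{1..n}. \<nu> D \<le> \<mu> D) \<longrightarrow>
        (SUP (l, D) \<in> H_chain {1..n}. chain_sum circ \<mu> \<nu> f l D) = gen_choquet n circ \<mu> \<nu> f)
     \<longleftrightarrow>
     (\<forall>a\<ge>0. \<forall>x\<ge>0. \<forall>y\<ge>0. circ a (x + y) \<le> circ a x + circ a y)"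
proof (intro iffI allI impI)
  fix a x y :: real
  assume H: "\<forall>(f :: nat \<Rightarrow> real) (\<mu> :: nat set \<Rightarrow> real) (\<nu> :: nat set \<Rightarrow> real).
      (\<forall>x\<in>{1..n}. 0 \<le> f x) \<longrightarrow>
      monotone_measure {1..n} \<mu> \<longrightarrow> symmetric_measure {1..n} \<mu> \<longrightarrow>
      monotone_measure {1..n} \<nu> \<longrightarrow> symmetric_measure {1..n} \<nu> \<longrightarrow>
      (\<forall>D\<subseteq>{1..n}. \<nu> D \<le> \<mu> D) \<longrightarrow>
      (SUP (l, D) \<in> H_chain {1..n}. chain_sum circ \<mu> \<nu> f l D) = gen_choquet n circ \<mu> \<nu> f"
    and a: "0 \<le> a" and xy: "0 \<le> x" "0 \<le> y"
  \<comment> \<open>The same measure is taken for both arguments, so the required domination is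
    trivial; nonnegativity of \<open>x\<close> and \<open>y\<close> makes it monotone.\<close>
  define \<mu> where
    "\<mu> = (\<lambda>D :: nat set. if card D = 0 then 0 else if card D = 1 then x else x + y)"
  have "mono_on (Pow {1..n}) \<mu>"
  proof (rule mono_onI)
    fix C D :: "nat set" assume "D \<in> Pow {1..n}" "C \<subseteq> D"
    then have "card C \<le> card D"
      by (intro card_mono) (auto intro: finite_subset)
    then show "\<mu> C \<le> \<mu> D"
      using xy by (auto simp: \<mu>_def)
  qed
  then have "monotone_measure {1..n} \<mu>"
    using xy by (auto simp: monotone_measure_def \<mu>_def)
  moreover have "symmetric_measure {1..n} \<mu>"
    by (simp add: symmetric_measure_def \<mu>_def)
  ultimately have "(SUP (l, D) \<in> H_chain {1..n}. chain_sum circ \<mu> \<mu> (\<lambda>_. a) l D)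
      = gen_choquet n circ \<mu> \<mu> (\<lambda>_. a)"
    using H[THEN spec[of _ "\<lambda>_. a"], THEN spec[of _ \<mu>], THEN spec[of _ \<mu>]] a by simp
  then have "chain_sum circ \<mu> \<mu> (\<lambda>_. a) l D \<le> gen_choquet n circ \<mu> \<mu> (\<lambda>_. a)"
    if "(l, D) \<in> H_chain {1..n}" for l D
    using chain_sum_le_SUP[OF _ that] by (metis finite_atLeastAtMost)
  then show "circ a (x + y) \<le> circ a x + circ a y"
    unfolding \<mu>_def by (rule subadditive_if_chain_sum_le[OF n xy])
next
  fix f :: "nat \<Rightarrow> real" and \<mu> \<nu> :: "nat set \<Rightarrow> real"
  assume sub: "\<forall>a\<ge>0. \<forall>x\<ge>0. \<forall>y\<ge>0. circ a (x + y) \<le> circ a x + circ a y"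
    and f: "\<forall>x\<in>{1..n}. 0 \<le> f x"
    and \<mu>: "monotone_measure {1..n} \<mu>" "symmetric_measure {1..n} \<mu>"
    and \<nu>: "monotone_measure {1..n} \<nu>" "symmetric_measure {1..n} \<nu>"
    and le: "\<forall>D\<subseteq>{1..n}. \<nu> D \<le> \<mu> D"
  show "(SUP (l, D) \<in> H_chain {1..n}. chain_sum circ \<mu> \<nu> f l D) = gen_choquet n circ \<mu> \<nu> f"
  \<comment> \<open>One inequality bounds every chain sum; the other exhibits a chain that attains
    the Choquet-like sum.\<close>
  proof (rule antisym)
    have "chain_sum circ \<mu> \<nu> f l D \<le> gen_choquet n circ \<mu> \<nu> f" if "(l, D) \<in> H_chain {1..n}" for l D
      using sub
      by (intro chain_sum_le_gen_choquet[OF circ_nonneg circ_mono _ f \<mu> \<nu>(2) le that]) auto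
    then show "(SUP (l, D) \<in> H_chain {1..n}. chain_sum circ \<mu> \<nu> f l D) \<le> gen_choquet n circ \<mu> \<nu> f"
      using n by (intro cSUP_least H_chain_nonempty) auto
    have "1 \<le> n"
      using n by simp
    then obtain D where "(n, D) \<in> H_chain {1..n}"
      "chain_sum circ \<mu> \<nu> f n D = gen_choquet n circ \<mu> \<nu> f"
      using gen_choquet_is_chain_sum[OF _ \<mu>(2) \<nu>(2)] by blast
    then show "gen_choquet n circ \<mu> \<nu> f \<le> (SUP (l, D) \<in> H_chain {1..n}. chain_sum circ \<mu> \<nu> f l D)"
      using chain_sum_le_SUP by (metis finite_atLeastAtMost)
  qed
qed

end
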